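(* Let $d\ge2$ and $m\ge d$ be integers with $m+1\equiv0\pmod d$. Let $\mu$ be the self-similar probability measure satisfying $\mu=\sum_{j=0}^m p_j\,\mu\circ S_j^{-1}$ with $S_j(x)=\frac1d x+\frac{j}{md}(d-1)$ and $p_j=\frac1{m+1}$ for all $j=0,\dots,m$. Then $$\dim_{loc}\mu(x)=1\ \text{ for all }x\in(0,1),\qquad \dim_{loc}\mu(0)=\dim_{loc}\mu(1)=\frac{\log(m+1)}{\log d}>1,$$ so the set of local dimensions of $\mu$ consists of exactly two elements.
   Context: The support of $\mu$ is $[0,1]$. $\dim_{loc}\mu(x)=\lim_{r\to0^+}\frac{\log\mu([x-r,x+r])}{\log r}$ when the limit exists. *)

theory Defs
  imports "HOL-Probability.Probability"
begin

text \<open>The Borel probability measures on the line satisfying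
  \<open>\<mu> = (\<Sum>j=0..m. p j * (\<mu> \<circ> (S j)\<^sup>-\<^sup>1))\<close>.\<close>

definition self_similar_measure ::
    "nat \<Rightarrow> (nat \<Rightarrow> real) \<Rightarrow> (nat \<Rightarrow> real \<Rightarrow> real) \<Rightarrow> real measure \<Rightarrow> bool" where
  "self_similar_measure m p S \<mu> \<longleftrightarrow>
     prob_space \<mu> \<and> sets \<mu> = sets borel \<and>
     (\<forall>A\<in>sets borel. measure \<mu> A = (\<Sum>j=0..m. p j * measure \<mu> (S j -` A)))"

definition ifs_map :: "nat \<Rightarrow> nat \<Rightarrow> nat \<Rightarrow> real \<Rightarrow> real" where
  "ifs_map d m j x = (1 / real d) * x + (real j / (real m * real d)) * (real d - 1)"

definition measure_support :: "real measure \<Rightarrow> real set" where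
  "measure_support \<mu> = {x. \<forall>U. open U \<longrightarrow> x \<in> U \<longrightarrow> measure \<mu> U > 0}"

text \<open>The limit exists and equals \<open>s\<close>. Since \<open>ln 0 = 0\<close> by convention, this is only meaningful
  at points of the support, where all the intervals have positive measure.\<close>

definition has_local_dim :: "real measure \<Rightarrow> real \<Rightarrow> real \<Rightarrow> bool" where
  "has_local_dim \<mu> x s \<longleftrightarrow>
     ((\<lambda>r. ln (measure \<mu> {x - r..x + r}) / ln r) \<longlongrightarrow> s) (at_right 0)"

definition local_dims :: "real measure \<Rightarrow> real set" where
  "local_dims \<mu> = {s. \<exists>x\<in>measure_support \<mu>. has_local_dim \<mu> x s}"

end

theory Submission
  imports Defs
begin

text \<open>Rescale the line by \<open>R = m / (d - 1)\<close>, so that the maps become \<open>w \<mapsto> (w + j) / d\<close> and the measure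
  \<open>\<nu>\<close> is the law of \<open>\<Sum>k\<ge>1. X k / d ^ k\<close> with \<open>X k\<close> independent and uniform on \<open>{0..m}\<close>. As \<open>d\<close>
  divides \<open>m + 1\<close>, the digits are equidistributed modulo \<open>d\<close>, hence \<open>\<nu>\<close> is uniform modulo \<open>1\<close> and
  an interval of length \<open>r\<close> has mass \<open>O(r)\<close>. Conversely, for \<open>z\<close> in \<open>(0, R)\<close> and large \<open>k\<close>, the
  preimages of a short interval at \<open>z\<close> under all compositions of \<open>k\<close> maps contain every integer
  translate, meeting \<open>[0, R]\<close>, of an interval that is \<open>d ^ k\<close> times longer; uniformity modulo \<open>1\<close> then
  bounds the mass below by a multiple of the length. Near \<open>0\<close> only the map with \<open>j = 0\<close> contributes,
  so that \<open>\<nu> [-t, t]\<close> decays like \<open>(m + 1) ^ -k\<close> for \<open>t = d ^ -k\<close>. Reflection carries \<open>0\<close> to \<open>1\<close>.\<close>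

section \<open>Power-law bounds and local dimension\<close>

lemma ex_power_scale:
  fixes t :: real and d :: nat
  assumes "d \<ge> 2" "0 < t" "t < 1"
  obtains n where "(1 / d) ^ Suc n \<le> t" "t < (1 / d) ^ n"
proof -
  let ?P = "\<lambda>n. (1 / real d) ^ n \<le> t"
  have "\<exists>n. (1 / real d) ^ n < t"
    using assms by (intro real_arch_pow_inv) auto
  then have ex: "\<exists>n. ?P n"
    using less_imp_le by blast
  define N where "N = (LEAST n. ?P n)"
  have N: "?P N"
    unfolding N_def using ex by (rule LeastI_ex)
  then have "N \<noteq> 0"
    using assms by (intro notI) simp
  then obtain n where n: "N = Suc n"
    using not0_implies_Suc by blast
  then have "\<not> ?P n"
    unfolding N_def by (metis not_less_Least lessI)
  with N n that show thesis by auto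
qed

text \<open>Ahlfors-type regularity at one point. It yields both the local dimension and membership
  in the support, and it survives affine changes of variable, so all estimates below aim at
  it.\<close>

definition regular_at :: "real measure \<Rightarrow> real \<Rightarrow> real \<Rightarrow> bool" where
  "regular_at \<mu> x s \<longleftrightarrow> (\<exists>a>0. \<exists>b. \<exists>e>0. \<forall>r. 0 < r \<and> r < e \<longrightarrow>
     a * r powr s \<le> measure \<mu> {x - r..x + r} \<and> measure \<mu> {x - r..x + r} \<le> b * r powr s)"

text \<open>Taking logarithms turns the constants into terms \<open>ln c / ln r\<close>, which
  vanish as \<open>r\<close> tends to 0. Since \<open>ln r < 0\<close> for small \<open>r\<close>,
  the upper bound on the mass bounds the quotient from below and vice versa.\<close>

lemma regular_at_has_local_dim:
  assumes "regular_at \<mu> x s"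
  shows "has_local_dim \<mu> x s"
proof -
  obtain a b e where a: "a > 0" and e: "e > 0"
    and lo: "\<And>r. 0 < r \<Longrightarrow> r < e \<Longrightarrow> a * r powr s \<le> measure \<mu> {x - r..x + r}"
    and up: "\<And>r. 0 < r \<Longrightarrow> r < e \<Longrightarrow> measure \<mu> {x - r..x + r} \<le> b * r powr s"
    using assms unfolding regular_at_def by blast
  \<comment> \<open>Comparing both bounds at a single radius forces \<open>b\<close> to be positive,
    so that \<open>ln b\<close> is meaningful.\<close>
  have "a * (e/2) powr s \<le> b * (e/2) powr s"
    using lo[of "e/2"] up[of "e/2"] e by linarith
  then have b: "b > 0"
    using a e by simp
  have ln0: "filterlim (\<lambda>r::real. ln r) at_bot (at_right 0)"
    by (rule ln_at_0)
  have lim: "((\<lambda>r::real. s + ln c / ln r) \<longlongrightarrow> s) (at_right 0)" for c :: real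
  proof -
    have "((\<lambda>r::real. ln c / ln r) \<longlongrightarrow> 0) (at_right 0)"
      by (rule tendsto_divide_0[OF tendsto_const filterlim_at_bot_imp_at_infinity[OF ln0]])
    from tendsto_add[OF tendsto_const this, of s] show ?thesis by simp
  qed
  have ev: "eventually (\<lambda>r::real. 0 < r \<and> r < min e 1) (at_right 0)"
    using e by (intro eventually_at_rightI[of 0 "min e 1"]) auto
  have up_ln: "ln (measure \<mu> {x - r..x + r}) / ln r \<le> s + ln a / ln r"
   and lo_ln: "s + ln b / ln r \<le> ln (measure \<mu> {x - r..x + r}) / ln r"
   if r: "0 < r \<and> r < min e 1" for r
  proof -
    let ?M = "measure \<mu> {x - r..x + r}"
    have M: "a * r powr s \<le> ?M" "?M \<le> b * r powr s"
      using lo up r by auto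
    have pos: "0 < a * r powr s" using a r by simp
    have l: "ln r < 0" using r by simp
    have "ln (a * r powr s) \<le> ln ?M" "ln ?M \<le> ln (b * r powr s)"
      using M pos by (simp_all)
    then have *: "ln a + s * ln r \<le> ln ?M" "ln ?M \<le> ln b + s * ln r"
      using a b r by (simp_all add: ln_mult ln_powr)
    have eq: "s + c / ln r = (c + s * ln r) / ln r" for c
      using l by (simp add: add_divide_distrib)
    show "ln ?M / ln r \<le> s + ln a / ln r" "s + ln b / ln r \<le> ln ?M / ln r"
      unfolding eq using * l by (auto intro: divide_right_mono_neg)
  qed
  show ?thesis
    unfolding has_local_dim_def
    by (rule tendsto_sandwich[OF _ _ lim[of b] lim[of a]])
       (use ev in \<open>auto elim!: eventually_mono intro: up_ln lo_ln\<close>)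
qed

lemma regular_at_support:
  assumes "regular_at \<mu> x s" "finite_measure \<mu>" "sets \<mu> = sets borel"
  shows "x \<in> measure_support \<mu>"
  unfolding measure_support_def
proof (clarify)
  fix U :: "real set" assume U: "open U" "x \<in> U"
  interpret finite_measure \<mu> by fact
  obtain a e where a: "a > 0" and e: "e > 0"
    and lo: "\<And>r. 0 < r \<Longrightarrow> r < e \<Longrightarrow> a * r powr s \<le> measure \<mu> {x - r..x + r}"
    using assms(1) unfolding regular_at_def by blast
  obtain f where f: "f > 0" "cball x f \<subseteq> U"
    using U open_contains_cball by blast
  define r where "r = min f (e/2)"
  have r: "0 < r" "r < e" "r \<le> f" using e f by (auto simp: r_def)
  have "0 < a * r powr s" using a r by simp
  also have "\<dots> \<le> measure \<mu> {x - r..x + r}" using lo r by simp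
  also have "\<dots> \<le> measure \<mu> U"
  proof (rule finite_measure_mono)
    show "{x - r..x + r} \<subseteq> U"
      using f r by (force simp: cball_eq_atLeastAtMost)
    show "U \<in> sets \<mu>" using U assms(3) by simp
  qed
  finally show "0 < measure \<mu> U" .
qed

text \<open>Scaling radii by \<open>c\<close> multiplies both constants by \<open>c powr s\<close>
  and leaves the exponent alone.\<close>

lemma regular_at_affine:
  fixes \<mu> \<nu> :: "real measure"
  assumes "regular_at \<nu> y s" "c > 0"
    and "\<And>r. r > 0 \<Longrightarrow> measure \<mu> {x - r..x + r} = measure \<nu> {y - c * r..y + c * r}"
  shows "regular_at \<mu> x s"
proof -
  obtain a b e where a: "a > 0" and e: "e > 0"
    and lo: "\<And>r. 0 < r \<Longrightarrow> r < e \<Longrightarrow> a * r powr s \<le> measure \<nu> {y - r..y + r}"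
    and up: "\<And>r. 0 < r \<Longrightarrow> r < e \<Longrightarrow> measure \<nu> {y - r..y + r} \<le> b * r powr s"
    using assms(1) unfolding regular_at_def by blast
  have "(a * c powr s) * r powr s \<le> measure \<mu> {x - r..x + r} \<and>
      measure \<mu> {x - r..x + r} \<le> (b * c powr s) * r powr s"
    if "0 < r \<and> r < e / c" for r
    using that lo[of "c * r"] up[of "c * r"] assms(2,3)
    by (simp add: powr_mult field_simps)
  moreover have "a * c powr s > 0" "e / c > 0" using a e assms(2) by auto
  ultimately show ?thesis unfolding regular_at_def by blast
qed

section \<open>The rescaled measure and its support\<close>

locale digit_law = prob_space \<nu> for \<nu> :: "real measure" +
  fixes d m q :: nat
  assumes sets_eq [simp, measurable_cong]: "sets \<nu> = sets borel"
    and d2: "d \<ge> 2" and dm: "d \<le> m" and mq: "m + 1 = d * q"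
    and self_similar: "A \<in> sets borel \<Longrightarrow>
      measure \<nu> A = (\<Sum>j\<le>m. measure \<nu> {w. (w + real j) / d \<in> A}) / (real m + 1)"
begin

text \<open>The fixed point of the last map \<open>w \<mapsto> (w + m) / d\<close>, hence the right
  end of the support; the first map fixes 0.\<close>

definition R :: real where "R = m / (real d - 1)"

lemma R_pos: "R > 0"
  using d2 dm by (simp add: R_def)

lemma R_eq: "d * R = R + m"
  using d2 by (simp add: R_def field_simps)

lemma vimage_borel [measurable]:
  fixes a c :: real
  assumes [measurable]: "A \<in> sets borel"
  shows "{w. (w + a) / c \<in> A} \<in> sets borel"
  by measurable

definition outer :: "real \<Rightarrow> real set" where
  "outer e = {..<- e} \<union> {R + e<..}"

lemma outer_borel [measurable]: "outer e \<in> sets borel"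
  by (simp add: outer_def)

lemma outer_antimono: "e \<le> e' \<Longrightarrow> outer e' \<subseteq> outer e"
  by (auto simp: outer_def)

text \<open>The maps send \<open>[0, R]\<close> into itself and contract by \<open>d\<close>, so a
  point whose image is more than \<open>e\<close> away from \<open>[0, R]\<close> is itself more
  than \<open>d * e\<close> away.\<close>

lemma outer_scale:
  fixes e :: real
  shows "measure \<nu> (outer e) \<le> measure \<nu> (outer (d * e))"
proof -
  have "{w. (w + real j) / d \<in> outer e} \<subseteq> outer (d * e)" if "j \<le> m" for j
  proof -
    have "real j \<le> m" using that by simp
    then show ?thesis
      using d2 R_eq by (auto simp: outer_def field_simps)
  qed
  then have "measure \<nu> {w. (w + real j) / d \<in> outer e} \<le> measure \<nu> (outer (d * e))" if "j \<le> m" for j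
    using that by (intro finite_measure_mono) auto
  then have "(\<Sum>j\<le>m. measure \<nu> {w. (w + real j) / d \<in> outer e}) \<le> (\<Sum>j\<le>m. measure \<nu> (outer (d * e)))"
    by (intro sum_mono) auto
  then show ?thesis
    by (subst self_similar) (auto simp: field_simps)
qed

text \<open>Iterating \<open>outer_scale\<close> bounds the mass by that of sets which decrease to
  the empty set.\<close>

lemma outer_null_pos:
  assumes "e > 0"
  shows "measure \<nu> (outer e) = 0"
proof -
  have le: "measure \<nu> (outer e) \<le> measure \<nu> (outer (real d ^ n * e))" for n
  proof (induction n)
    case (Suc n)
    then show ?case using outer_scale[of "real d ^ n * e"] by (simp add: mult.assoc)
  qed simp
  have "decseq (\<lambda>n. outer (real d ^ n * e))"
  proof (rule decseq_SucI)
    fix n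
    have "real d ^ n * e \<le> real d ^ Suc n * e"
      using d2 assms by (intro mult_right_mono power_increasing) auto
    then show "outer (real d ^ Suc n * e) \<subseteq> outer (real d ^ n * e)"
      by (rule outer_antimono)
  qed
  then have "(\<lambda>n. measure \<nu> (outer (real d ^ n * e))) \<longlonglongrightarrow> measure \<nu> (\<Inter>n. outer (real d ^ n * e))"
    by (intro finite_Lim_measure_decseq) auto
  moreover have "(\<Inter>n. outer (real d ^ n * e)) = {}"
  proof -
    have "\<exists>n. w \<notin> outer (real d ^ n * e)" for w
    proof -
      obtain n where "\<bar>w\<bar> / e < real d ^ n"
        using real_arch_pow[of "real d"] d2 by auto
      then have "\<bar>w\<bar> < real d ^ n * e" using assms by (simp add: field_simps)
      then show ?thesis using R_pos by (intro exI[of _ n]) (auto simp: outer_def)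
    qed
    then show ?thesis by auto
  qed
  ultimately have "(\<lambda>n. measure \<nu> (outer (real d ^ n * e))) \<longlonglongrightarrow> 0" by simp
  then have "measure \<nu> (outer e) \<le> 0"
    using le by (intro LIMSEQ_le_const) auto
  then show ?thesis by (simp add: measure_le_0_iff)
qed

lemma outer_null: "measure \<nu> (outer 0) = 0"
proof -
  have "incseq (\<lambda>n. outer (1 / Suc n))"
    by (intro incseq_SucI outer_antimono) (simp add: field_simps)
  then have "(\<lambda>n. measure \<nu> (outer (1 / Suc n))) \<longlonglongrightarrow> measure \<nu> (\<Union>n. outer (1 / Suc n))"
    by (intro finite_Lim_measure_incseq) auto
  moreover have "(\<Union>n. outer (1 / Suc n)) = outer 0"
  proof -
    have "\<exists>n. w \<in> outer (1 / Suc n)" if w: "w \<in> outer 0" for w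
    proof -
      have "0 < max (- w) (w - R)" using w by (auto simp: outer_def)
      then obtain n where n: "inverse (real (Suc n)) < max (- w) (w - R)"
        using reals_Archimedean by blast
      then show ?thesis
        by (intro exI[of _ n]) (auto simp: outer_def inverse_eq_divide)
    qed
    moreover have "outer (1 / Suc n) \<subseteq> outer 0" for n
      by (rule outer_antimono) simp
    ultimately show ?thesis by blast
  qed
  ultimately show ?thesis
    using outer_null_pos LIMSEQ_unique[OF _ tendsto_const] by auto
qed

lemma measure_Int_support:
  assumes "A \<in> sets borel"
  shows "measure \<nu> (A \<inter> {0..R}) = measure \<nu> A"
proof (rule measure_eq_AE)
  have "emeasure \<nu> (outer 0) = 0"
    using outer_null by (simp add: emeasure_eq_measure)
  then have "AE w in \<nu>. w \<notin> outer 0"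
    by (intro AE_not_in) (auto simp: null_sets_def)
  then show "AE w in \<nu>. (w \<in> A \<inter> {0..R}) = (w \<in> A)"
    by eventually_elim (auto simp: outer_def)
qed (use assms in auto)

section \<open>Uniformity modulo 1 and the upper bound\<close>

text \<open>The lift to the line of an arc of length \<open>\<delta>\<close> in the circle of reals
  modulo 1.\<close>

definition comb :: "real \<Rightarrow> real \<Rightarrow> real set" where
  "comb z \<delta> = (\<Union>l::int. {z + l..<z + l + \<delta>})"

lemma comb_borel [measurable]: "comb z \<delta> \<in> sets borel"
  by (auto simp: comb_def)

lemma mem_comb_vimage:
  fixes w z \<delta> :: real
  shows "(w + real j) / d \<in> comb z \<delta> \<longleftrightarrow> (\<exists>l::int. d * z + d * l \<le> w + j \<and> w + j < d * z + d * l + d * \<delta>)"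
  using d2 by (simp add: comb_def field_simps)

text \<open>The preimage of a comb under map \<open>j\<close> depends only on \<open>j\<close>
  modulo \<open>d\<close>, and the preimages for the \<open>d\<close> residues partition the
  enlarged comb. Each residue occurs \<open>q\<close> times among the \<open>m + 1 = d * q\<close>
  digits, which leaves the factor \<open>1 / d\<close>.\<close>

lemma comb_scale:
  fixes z \<delta> :: real
  assumes "d * \<delta> \<le> 1"
  shows "measure \<nu> (comb z \<delta>) = measure \<nu> (comb (d * z) (d * \<delta>)) / d"
proof -
  define E where "E j = {w. (w + real j) / d \<in> comb z \<delta>}" for j
  have E: "w \<in> E j \<longleftrightarrow> (\<exists>l::int. d * z + d * l \<le> w + j \<and> w + j < d * z + d * l + d * \<delta>)" for w j
    by (simp add: E_def mem_comb_vimage)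
  have period: "E (i + b * d) = E i" for i b
  proof -
    have "w \<in> E (i + b * d)" if "w \<in> E i" for w
    proof -
      from that obtain l :: int where "d * z + d * l \<le> w + i \<and> w + i < d * z + d * l + d * \<delta>"
        using E by blast
      then show ?thesis unfolding E
        by (intro exI[of _ "l + int b"]) (simp add: algebra_simps)
    qed
    moreover have "w \<in> E i" if "w \<in> E (i + b * d)" for w
    proof -
      from that obtain l :: int where
        "d * z + d * l \<le> w + real (i + b * d) \<and> w + real (i + b * d) < d * z + d * l + d * \<delta>"
        using E by blast
      then show ?thesis unfolding E
        by (intro exI[of _ "l - int b"]) (simp add: algebra_simps)
    qed
    ultimately show ?thesis by blast
  qed
  have un: "(\<Union>i<d. E i) = comb (d * z) (d * \<delta>)"
  proof (rule set_eqI)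
    fix w
    have "w \<in> (\<Union>i<d. E i)" if "w \<in> comb (d * z) (d * \<delta>)"
    proof -
      from that obtain k :: int where k: "d * z + k \<le> w" "w < d * z + k + d * \<delta>"
        by (auto simp: comb_def)
      \<comment> \<open>Division of \<open>- k\<close> by \<open>d\<close> gives
        \<open>i = - k + d * l\<close>, so tooth \<open>k\<close> of the enlarged comb belongs to
        the residue \<open>i\<close>.\<close>
      define i where "i = nat ((- k) mod d)"
      define l where "l = - ((- k) div d)"
      have i: "i < d" using d2 by (simp add: i_def nat_less_iff)
      have "int i = (- k) mod d" using d2 by (simp add: i_def)
      then have "int i = - k + d * l" by (simp add: l_def minus_mult_div_eq_mod[symmetric])
      then have "real_of_int (int i) = real_of_int (- k + d * l)" by (rule arg_cong)
      then have "real i = - k + d * l" by simp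
      then have "w \<in> E i" using k unfolding E by (intro exI[of _ l]) simp
      with i show ?thesis by blast
    qed
    moreover have "w \<in> comb (d * z) (d * \<delta>)" if "w \<in> E i" for i
    proof -
      from that obtain l :: int where "d * z + d * l \<le> w + i \<and> w + i < d * z + d * l + d * \<delta>"
        using E by blast
      then show ?thesis unfolding comb_def
        by (intro UN_I[of "d * l - i"]) (auto simp: algebra_simps)
    qed
    ultimately show "w \<in> (\<Union>i<d. E i) \<longleftrightarrow> w \<in> comb (d * z) (d * \<delta>)" by blast
  qed
  have disj: "disjoint_family_on E {..<d}"
  proof -
    have "i = i'" if i: "i < d" "i' < d" "w \<in> E i" "w \<in> E i'" for i i' w
    proof -
      obtain l l' :: int where
        l: "d * z + d * l \<le> w + i" "w + i < d * z + d * l + d * \<delta>" and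
        l': "d * z + d * l' \<le> w + i'" "w + i' < d * z + d * l' + d * \<delta>"
        using i E by metis
      \<comment> \<open>Both teeth contain \<open>w\<close>, start at integer offsets from
        \<open>d * z\<close> and have length at most 1; being half-open, they must have the same
        offset.\<close>
      have "real_of_int (int d * l - int i) < real_of_int (int d * l' - int i' + 1)"
           "real_of_int (int d * l' - int i') < real_of_int (int d * l - int i + 1)"
        using l l' assms by simp_all
      then have "int d * l - int i = int d * l' - int i'" by linarith
      then have "int i - int i' = int d * (l - l')" by (simp add: algebra_simps)
      then have "int d dvd int i - int i'" by simp
      moreover have "\<bar>int i - int i'\<bar> < int d" using i by auto
      ultimately have "int i - int i' = 0" by (meson dvd_imp_le_int not_less order.strict_trans2 abs_ge_self)
      then show ?thesis by simp
    qed
    then show ?thesis unfolding disjoint_family_on_def by blast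
  qed
  have EB [measurable]: "E i \<in> sets borel" for i unfolding E_def by simp
  have "(\<Sum>j\<le>m. measure \<nu> (E j)) = (\<Sum>j<q * d. measure \<nu> (E j))"
    using mq by (simp add: lessThan_Suc_atMost[symmetric] mult.commute)
  also have "\<dots> = (\<Sum>b<q. \<Sum>j\<in>{b * d..<b * d + d}. measure \<nu> (E j))"
    by (rule sum.nat_group[symmetric])
  also have "\<dots> = (\<Sum>b<q. \<Sum>i<d. measure \<nu> (E i))"
  proof (rule sum.cong[OF refl])
    fix b
    have "(\<Sum>j\<in>{b * d..<b * d + d}. measure \<nu> (E j)) = (\<Sum>i\<in>{0..<d}. measure \<nu> (E (i + b * d)))"
      using sum.shift_bounds_nat_ivl[of "\<lambda>j. measure \<nu> (E j)" 0 "b * d" d] by (simp add: add.commute)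
    then show "(\<Sum>j\<in>{b * d..<b * d + d}. measure \<nu> (E j)) = (\<Sum>i<d. measure \<nu> (E i))"
      by (simp add: period atLeast0LessThan)
  qed
  also have "\<dots> = q * (\<Sum>i<d. measure \<nu> (E i))" by simp
  also have "(\<Sum>i<d. measure \<nu> (E i)) = measure \<nu> (\<Union>i<d. E i)"
    using disj by (intro finite_measure_finite_Union[symmetric]) auto
  finally have "(\<Sum>j\<le>m. measure \<nu> (E j)) = q * measure \<nu> (comb (d * z) (d * \<delta>))"
    by (simp add: un)
  then have "measure \<nu> (comb z \<delta>) = q * measure \<nu> (comb (d * z) (d * \<delta>)) / (real m + 1)"
    by (subst self_similar) (simp_all add: E_def)
  also have "real m + 1 = real d * real q" using mq by (metis of_nat_mult of_nat_Suc Suc_eq_plus1 add.commute)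
  finally show ?thesis using mq by (cases "q = 0") (auto simp: field_simps)
qed

lemma measure_comb:
  fixes z :: real
  shows "measure \<nu> (comb z ((1 / d) ^ n)) = (1 / d) ^ n"
proof (induction n arbitrary: z)
  case 0
  have "w \<in> comb z 1" for w
    unfolding comb_def by (intro UN_I[of "\<lfloor>w - z\<rfloor>"]) (auto simp: algebra_simps, linarith+)
  then have "comb z 1 = space \<nu>"
    using sets_eq_imp_space_eq[OF sets_eq] by auto
  then show ?case by (simp add: prob_space)
next
  case (Suc n)
  have *: "real d * (1 / d) ^ Suc n = (1 / d) ^ n" using d2 by simp
  have "(1 / real d) ^ n \<le> 1" using d2 by (intro power_le_one) auto
  then show ?case
    using comb_scale[of "(1 / d) ^ Suc n" z] Suc.IH[of "d * z"] unfolding * by simp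
qed

text \<open>The interval fits into one tooth of a comb whose tooth length \<open>(1 / d) ^ n\<close>
  is at most \<open>d\<close> times the interval length \<open>2 * t\<close>.\<close>

lemma measure_Icc_le:
  fixes z t :: real
  assumes "0 < t" "t < 1 / 2"
  shows "measure \<nu> {z - t..z + t} \<le> 2 * d * t"
proof -
  obtain n where n: "(1 / d) ^ Suc n \<le> 2 * t" "2 * t < (1 / d) ^ n"
    using ex_power_scale[of d "2 * t"] d2 assms by auto
  have "measure \<nu> {z - t..z + t} \<le> measure \<nu> (comb (z - t) ((1 / d) ^ n))"
    using n by (intro finite_measure_mono) (auto simp: comb_def intro!: exI[of _ 0])
  also have "\<dots> = (1 / d) ^ n" by (rule measure_comb)
  also have "\<dots> \<le> 2 * d * t" using n d2 by (simp add: field_simps)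
  finally show ?thesis .
qed

section \<open>Digit sums and the lower bound at interior points\<close>

text \<open>The integers with a representation by \<open>k\<close> base-\<open>d\<close> digits in \<open>{0..m}\<close> are exactly \<open>0, \<dots>, M k\<close>,
  because \<open>m \<ge> d - 1\<close> leaves no gaps.\<close>

definition M :: "nat \<Rightarrow> nat" where "M k = m * (\<Sum>i<k. d ^ i)"

lemma M_Suc: "M (Suc k) = M k + m * d ^ k"
  by (simp add: M_def algebra_simps)

lemma M_eq: "real (M k) = R * (real d ^ k - 1)"
proof (induction k)
  case (Suc k)
  have "R * (real d ^ Suc k - 1) = (d * R) * d ^ k - R" by (simp add: algebra_simps)
  also have "\<dots> = R * (real d ^ k - 1) + m * d ^ k" by (simp add: R_eq algebra_simps)
  finally show ?case using Suc by (simp add: M_Suc)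
qed (simp add: M_def)

lemma M_ge: "d ^ k \<le> M k + 1"
proof (induction k)
  case (Suc k)
  have "d ^ Suc k = d ^ k + (d - 1) * d ^ k" using d2 by (cases d) auto
  also have "\<dots> \<le> (M k + 1) + m * d ^ k"
    using Suc dm by (intro add_mono mult_right_mono) auto
  finally show ?case by (simp add: M_Suc)
qed simp

text \<open>The leading digit is the quotient by \<open>d ^ k\<close>, capped at \<open>m\<close>.
  Without the cap, \<open>M_ge\<close> makes the remainder small enough; with it, the bound on
  \<open>s\<close> does.\<close>

lemma digit_decomposition:
  assumes "s \<le> M (Suc k)"
  obtains j t where "j \<le> m" "t \<le> M k" "s = d ^ k * j + t"
proof (cases "s div d ^ k \<le> m")
  case True
  have "s mod d ^ k < d ^ k" using d2 by simp
  then have "s mod d ^ k \<le> M k" using M_ge[of k] by linarith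
  with True that[of "s div d ^ k" "s mod d ^ k"] show ?thesis by simp
next
  case False
  then have "m * d ^ k \<le> (s div d ^ k) * d ^ k" by (intro mult_right_mono) auto
  also have "\<dots> \<le> s" by simp
  finally show ?thesis using assms that[of m "s - d ^ k * m"]
    by (simp add: M_Suc mult.commute)
qed

text \<open>A composition of \<open>k\<close> maps is \<open>w \<mapsto> (w + s) / d ^ k\<close>,
  where \<open>s\<close> is the value of its digit string. Every \<open>s \<le> M k\<close> comes
  from at least one of the \<open>(m + 1) ^ k\<close> equally weighted strings, so subadditivity
  suffices and multiplicities can be ignored.\<close>

lemma measure_ge_iterate:
  assumes "A \<in> sets borel"
  shows "measure \<nu> (\<Union>s\<le>M k. {w. (w + real s) / d ^ k \<in> A}) / (real m + 1) ^ k \<le> measure \<nu> A"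
  using assms
proof (induction k arbitrary: A)
  case (Suc k)
  define B where "B j = {w. (w + real j) / d \<in> A}" for j
  define V where "V j = (\<Union>s\<le>M k. {w. (w + real s) / d ^ k \<in> B j})" for j
  have B [measurable]: "B j \<in> sets borel" for j unfolding B_def using Suc.prems by simp
  have V [measurable]: "V j \<in> sets borel" for j
  proof -
    have "{w. (w + real s) / d ^ k \<in> B j} \<in> sets borel" for s by (rule vimage_borel[OF B])
    then show ?thesis unfolding V_def by auto
  qed
  have IH: "measure \<nu> (V j) / (real m + 1) ^ k \<le> measure \<nu> (B j)" for j
    using Suc.IH[OF B] by (simp add: V_def)
  have sub: "(\<Union>s\<le>M (Suc k). {w. (w + real s) / d ^ Suc k \<in> A}) \<subseteq> (\<Union>j\<le>m. V j)"
  proof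
    fix w assume "w \<in> (\<Union>s\<le>M (Suc k). {w. (w + real s) / d ^ Suc k \<in> A})"
    then obtain s where s: "s \<le> M (Suc k)" and w: "(w + real s) / (real d * real d ^ k) \<in> A"
      by auto
    obtain j t where jt: "j \<le> m" "t \<le> M k" "s = d ^ k * j + t"
      using digit_decomposition[OF s] .
    have "((w + real t) / d ^ k + j) / d = (w + real s) / (real d * real d ^ k)"
      using d2 by (simp add: jt(3) field_simps)
    then have "w \<in> {w. (w + real t) / d ^ k \<in> B j}" using w by (simp add: B_def)
    then have "w \<in> V j" unfolding V_def using jt(2) by blast
    then show "w \<in> (\<Union>j\<le>m. V j)" using jt(1) by blast
  qed
  have "measure \<nu> (\<Union>s\<le>M (Suc k). {w. (w + real s) / d ^ Suc k \<in> A}) \<le> measure \<nu> (\<Union>j\<le>m. V j)"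
    by (intro finite_measure_mono sub) auto
  also have "\<dots> \<le> (\<Sum>j\<le>m. measure \<nu> (V j))"
    by (intro finite_measure_subadditive_finite) auto
  also have "\<dots> \<le> (\<Sum>j\<le>m. measure \<nu> (B j) * (real m + 1) ^ k)"
    using IH by (intro sum_mono) (simp add: field_simps)
  also have "\<dots> = measure \<nu> A * (real m + 1) ^ Suc k"
  proof -
    have "(\<Sum>j\<le>m. measure \<nu> (B j)) = measure \<nu> A * (real m + 1)"
      using self_similar[OF Suc.prems] by (simp add: B_def field_simps)
    then show ?thesis by (simp add: sum_distrib_right[symmetric])
  qed
  finally show ?case by (subst pos_divide_le_eq) simp_all
qed (simp add: M_def)

text \<open>The union of the preimages covers the part of a comb inside \<open>[0, R]\<close>, and
  the mass of that comb is known exactly. The two conditions on \<open>z\<close> keep it, after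
  scaling by \<open>d ^ k\<close>, at distance at least \<open>R\<close> from both ends.\<close>

lemma measure_Ico_ge:
  fixes z :: real
  assumes z: "R \<le> d ^ k * z" "R \<le> d ^ k * (R - z)" and n: "k \<le> n"
  shows "(d / (real m + 1)) ^ k * (1 / d) ^ n \<le> measure \<nu> {z..<z + (1 / d) ^ n}"
proof -
  let ?U = "\<Union>s\<le>M k. {w. (w + real s) / d ^ k \<in> {z..<z + (1 / d) ^ n}}"
  have split: "(1 / real d) ^ n * d ^ k = (1 / d) ^ (n - k)"
    using n d2 by (simp add: power_divide power_diff)
  have sub: "comb (d ^ k * z) ((1 / d) ^ (n - k)) \<inter> {0..R} \<subseteq> ?U"
  proof
    fix w assume "w \<in> comb (d ^ k * z) ((1 / d) ^ (n - k)) \<inter> {0..R}"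
    then obtain l :: int where w: "0 \<le> w" "w \<le> R"
      and l: "d ^ k * z + l \<le> w" "w < d ^ k * z + l + (1 / d) ^ (n - k)"
      by (auto simp: comb_def)
    have "(1 / real d) ^ (n - k) \<le> 1" using d2 by (intro power_le_one) auto
    \<comment> \<open>A tooth meeting \<open>[0, R]\<close> must have its shift \<open>- l\<close>
      between 0 and \<open>M k\<close>: the condition at the right end gives the upper bound, the
      one at the left end gives \<open>l \<le> 0\<close>.\<close>
    then have lt: "real_of_int (- l) < real (M k) + 1"
      using l w z(2) M_eq[of k] by (simp add: algebra_simps)
    have l0: "l \<le> 0" using l w z(1) by linarith
    define s where "s = nat (- l)"
    have s: "real s = - l" using l0 by (simp add: s_def)
    then have "s \<le> M k" using lt by linarith
    moreover have "(w + real s) / d ^ k \<in> {z..<z + (1 / d) ^ n}"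
      using l s d2 unfolding split[symmetric]
      by (simp add: pos_le_divide_eq pos_divide_less_eq algebra_simps)
    ultimately show "w \<in> ?U" by blast
  qed
  have UB: "?U \<in> sets borel"
    by (intro sets.finite_UN) (auto, measurable)
  have "(1 / d) ^ n * d ^ k = measure \<nu> (comb (d ^ k * z) ((1 / d) ^ (n - k)))"
    by (simp only: measure_comb split)
  also have "\<dots> = measure \<nu> (comb (d ^ k * z) ((1 / d) ^ (n - k)) \<inter> {0..R})"
    by (simp add: measure_Int_support)
  also have "\<dots> \<le> measure \<nu> ?U"
    using UB by (intro finite_measure_mono sub) simp
  also have "\<dots> \<le> measure \<nu> {z..<z + (1 / d) ^ n} * (real m + 1) ^ k"
    using measure_ge_iterate[of "{z..<z + (1 / d) ^ n}" k] by (simp add: field_simps)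
  finally have "(1 / d) ^ n * d ^ k / (real m + 1) ^ k \<le> measure \<nu> {z..<z + (1 / d) ^ n}"
    by (subst pos_divide_le_eq) simp_all
  then show ?thesis by (simp add: power_divide mult.commute)
qed

lemma regular_at_interior:
  fixes z :: real
  assumes "0 < z" "z < R"
  shows "regular_at \<nu> z 1"
proof -
  have "real d > 1" using d2 by simp
  then obtain k where k: "max (R / z) (R / (R - z)) < real d ^ k"
    using real_arch_pow by blast
  then have z: "R \<le> d ^ k * z" "R \<le> d ^ k * (R - z)"
    using assms by (simp_all add: field_simps)
  \<comment> \<open>The bound 1/2 serves \<open>measure_Icc_le\<close>; the power of
    \<open>1 / d\<close> forces \<open>k \<le> Suc n\<close> below. As \<open>k\<close> depends on
    \<open>z\<close> only, so does the constant \<open>a\<close>.\<close>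
  define e where "e = min (1 / 2) ((1 / real d) ^ k)"
  define a where "a = (real d / (real m + 1)) ^ k / d"
  have "a * t powr 1 \<le> measure \<nu> {z - t..z + t} \<and> measure \<nu> {z - t..z + t} \<le> (2 * d) * t powr 1"
    if t: "0 < t \<and> t < e" for t
  proof
    obtain n where n: "(1 / d) ^ Suc n \<le> t" "t < (1 / d) ^ n"
      using ex_power_scale[of d t] d2 t by (auto simp: e_def)
    have "k \<le> Suc n"
    proof (rule ccontr)
      assume "\<not> k \<le> Suc n"
      then have "(1 / real d) ^ k \<le> (1 / d) ^ Suc n"
        using d2 by (intro power_decreasing) auto
      then show False using n t by (simp add: e_def)
    qed
    note low = measure_Ico_ge[OF z this]
    have "a * t \<le> (real d / (real m + 1)) ^ k * (1 / d) ^ Suc n"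
    proof -
      have "t / d \<le> (1 / d) ^ Suc n" using n d2 by (simp add: field_simps)
      then have "(real d / (real m + 1)) ^ k * (t / d) \<le> (real d / (real m + 1)) ^ k * (1 / d) ^ Suc n"
        by (intro mult_left_mono) auto
      then show ?thesis by (simp add: a_def)
    qed
    also note low
    also have "measure \<nu> {z..<z + (1 / d) ^ Suc n} \<le> measure \<nu> {z - t..z + t}"
      using n t by (intro finite_measure_mono) auto
    finally show "a * t powr 1 \<le> measure \<nu> {z - t..z + t}" using t by simp
    show "measure \<nu> {z - t..z + t} \<le> (2 * d) * t powr 1"
      using measure_Icc_le[of t z] t by (simp add: e_def)
  qed
  moreover have "a > 0" "e > 0" using d2 by (simp_all add: a_def e_def)
  ultimately show ?thesis unfolding regular_at_def by blast
qed

section \<open>Decay of the mass at the left endpoint\<close>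

lemma vimage_Icc:
  fixes t :: real
  shows "{w. (w + real j) / d \<in> {- t..t}} = {- (d * t) - j..d * t - j}"
  using d2 by (auto simp: field_simps)

text \<open>Only the term \<open>j = 0\<close> of the self-similarity relation is kept at each
  step.\<close>

lemma measure_Icc_0_ge:
  fixes t :: real
  shows "measure \<nu> {- (d ^ k * t)..d ^ k * t} / (real m + 1) ^ k \<le> measure \<nu> {- t..t}"
proof (induction k)
  case (Suc k)
  let ?u = "d ^ k * t"
  have "measure \<nu> {w. (w + real 0) / d \<in> {- ?u..?u}} \<le> (\<Sum>j\<le>m. measure \<nu> {w. (w + real j) / d \<in> {- ?u..?u}})"
    by (rule member_le_sum) auto
  then have "measure \<nu> {- (d * ?u)..d * ?u} / (real m + 1) \<le> measure \<nu> {- ?u..?u}"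
    using self_similar[of "{- ?u..?u}"] unfolding vimage_Icc by (simp add: divide_right_mono)
  then have "measure \<nu> {- (d * ?u)..d * ?u} / (real m + 1) / (real m + 1) ^ k \<le> measure \<nu> {- ?u..?u} / (real m + 1) ^ k"
    by (rule divide_right_mono) simp
  also note Suc
  finally show ?case by (simp add: mult.assoc)
qed simp

text \<open>For \<open>j \<ge> 1\<close> the preimage lies entirely to the left of 0, outside the
  support, so keeping only \<open>j = 0\<close> is exact.\<close>

lemma measure_Icc_0_scale:
  fixes t :: real
  assumes "d * t < 1"
  shows "measure \<nu> {- t..t} = measure \<nu> {- (d * t)..d * t} / (real m + 1)"
proof -
  have "measure \<nu> {- (d * t) - j..d * t - j} = 0" if "j \<noteq> 0" for j :: nat
  proof -
    have "{- (d * t) - real j..d * t - j} \<inter> {0..R} = {}"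
      using assms that by auto
    then show ?thesis using measure_Int_support[of "{- (d * t) - j..d * t - j}"] by simp
  qed
  then have "(\<Sum>j\<le>m. measure \<nu> {w. (w + real j) / d \<in> {- t..t}}) =
      (\<Sum>j\<le>m. if j = 0 then measure \<nu> {- (d * t)..d * t} else 0)"
    unfolding vimage_Icc by (intro sum.cong) auto
  also have "\<dots> = measure \<nu> {- (d * t)..d * t}"
    by simp
  finally show ?thesis using self_similar[of "{- t..t}"] by simp
qed

lemma measure_Icc_0_le:
  fixes t :: real
  assumes "0 < t" "t < (1 / d) ^ k"
  shows "measure \<nu> {- t..t} \<le> 1 / (real m + 1) ^ k"
  using assms
proof (induction k arbitrary: t)
  case (Suc k)
  have lt: "d * t < (1 / d) ^ k" using Suc.prems d2 by (simp add: field_simps)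
  also have "(1 / real d) ^ k \<le> 1" using d2 by (intro power_le_one) auto
  finally have "measure \<nu> {- t..t} = measure \<nu> {- (d * t)..d * t} / (real m + 1)"
    by (rule measure_Icc_0_scale)
  also have "\<dots> \<le> (1 / (real m + 1) ^ k) / (real m + 1)"
    using Suc.IH[of "d * t"] Suc.prems lt d2 by (intro divide_right_mono) auto
  finally show ?case by (simp only: power_Suc2 divide_divide_eq_left)
qed simp

text \<open>The exponent is chosen so that \<open>d powr s = m + 1\<close>: shrinking the radius by
  \<open>d\<close> costs exactly the factor \<open>m + 1\<close> in mass.\<close>

lemma regular_at_0: "regular_at \<nu> 0 (ln (real m + 1) / ln d)"
proof -
  define s where "s = ln (real m + 1) / ln d"
  have s0: "s \<ge> 0" using d2 by (simp add: s_def)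
  have ds: "real d powr s = m + 1"
    using d2 by (simp add: s_def powr_def)
  have pw: "((1 / d) ^ k) powr s = 1 / (real m + 1) ^ k" for k
  proof -
    have "((1 / d) ^ k) powr s = ((1 / d) powr s) ^ k"
      using d2 by (simp add: powr_power powr_realpow[symmetric] powr_powr mult.commute)
    also have "(1 / d) powr s = 1 / (real m + 1)" using ds d2 by (simp add: powr_divide)
    finally show ?thesis by (simp add: power_divide)
  qed
  have "(1 / (d * R)) powr s * t powr s \<le> measure \<nu> {0 - t..0 + t} \<and>
      measure \<nu> {0 - t..0 + t} \<le> d powr s * t powr s"
    if t: "0 < t \<and> t < min 1 R" for t
  proof
    \<comment> \<open>Measuring \<open>t\<close> in units of \<open>R\<close> makes the interval,
      enlarged by \<open>d ^ Suc n\<close>, cover the whole support and so have mass 1.\<close>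
    obtain n where n: "(1 / d) ^ Suc n \<le> t / R" "t / R < (1 / d) ^ n"
      using ex_power_scale[of d "t / R"] d2 t R_pos by auto
    have "R \<le> d ^ Suc n * t" using n(1) R_pos d2 by (simp add: field_simps power_divide)
    then have "measure \<nu> ({- (d ^ Suc n * t)..d ^ Suc n * t} \<inter> {0..R}) = measure \<nu> (UNIV \<inter> {0..R})"
      using R_pos by (intro arg_cong[of _ _ "measure \<nu>"]) auto
    also have "\<dots> = measure \<nu> UNIV" by (intro measure_Int_support) simp
    also have "\<dots> = 1" using prob_space sets_eq_imp_space_eq[OF sets_eq] by simp
    finally have one: "measure \<nu> {- (d ^ Suc n * t)..d ^ Suc n * t} = 1"
      by (subst (asm) measure_Int_support) simp
    have "(1 / (d * R)) powr s * t powr s = (t / R / d) powr s"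
      using t R_pos d2 by (simp flip: powr_mult add: mult.commute)
    also have "\<dots> \<le> ((1 / d) ^ Suc n) powr s"
      using n(2) t R_pos d2 s0 by (intro powr_mono2) (auto simp: field_simps)
    also have "\<dots> = 1 / (real m + 1) ^ Suc n" by (rule pw)
    also have "\<dots> \<le> measure \<nu> {- t..t}" using measure_Icc_0_ge[of "Suc n" t] one by simp
    finally show "(1 / (d * R)) powr s * t powr s \<le> measure \<nu> {0 - t..0 + t}" by simp
  next
    obtain n where n: "(1 / d) ^ Suc n \<le> t" "t < (1 / d) ^ n"
      using ex_power_scale[of d t] d2 t by auto
    have "measure \<nu> {- t..t} \<le> 1 / (real m + 1) ^ n" using measure_Icc_0_le[of t n] n t by simp
    also have "\<dots> = ((1 / d) ^ n) powr s" by (simp add: pw)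
    also have "\<dots> \<le> (d * t) powr s"
      using n(1) t d2 s0 by (intro powr_mono2) (auto simp: field_simps)
    also have "\<dots> = d powr s * t powr s" using t by (simp add: powr_mult)
    finally show "measure \<nu> {0 - t..0 + t} \<le> d powr s * t powr s" by simp
  qed
  moreover have "(1 / (d * R)) powr s > 0" "min 1 R > 0" using R_pos d2 by auto
  ultimately show ?thesis unfolding regular_at_def s_def[symmetric] by blast
qed

end

section \<open>Transfer to the original measure\<close>

lemma measure_rescale:
  fixes \<mu> :: "real measure"
  assumes "sets \<mu> = sets borel" "A \<in> sets borel"
  shows "measure (distr \<mu> borel (\<lambda>x. c * x)) A = measure \<mu> {x. c * x \<in> A}"
proof -
  note [measurable_cong] = assms(1)
  show ?thesis using assms sets_eq_imp_space_eq[OF assms(1)]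
    by (subst measure_distr) (auto simp: vimage_def)
qed

context
  fixes d m :: nat
  assumes d2: "d \<ge> 2" and dm: "m \<ge> d" and dvd: "(m + 1) mod d = 0"
begin

lemma digit_law_rescale:
  assumes "self_similar_measure m (\<lambda>j. 1 / (real m + 1)) (ifs_map d m) \<mu>"
  shows "digit_law (distr \<mu> borel (\<lambda>x. m / (real d - 1) * x)) d m ((m + 1) div d)"
proof -
  let ?R = "m / (real d - 1)"
  have \<mu>: "prob_space \<mu>" and sets [simp, measurable_cong]: "sets \<mu> = sets borel"
    and ss: "\<And>A. A \<in> sets borel \<Longrightarrow> measure \<mu> A = (\<Sum>j=0..m. 1 / (real m + 1) * measure \<mu> (ifs_map d m j -` A))"
    using assms by (auto simp: self_similar_measure_def)
  have sp: "space \<mu> = UNIV" using sets_eq_imp_space_eq[OF sets] by simp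
  interpret prob_space \<mu> by fact
  show ?thesis
  proof (rule digit_law.intro)
    show "prob_space (distr \<mu> borel (\<lambda>x. ?R * x))"
      by (rule prob_space_distr) simp
    show "digit_law_axioms (distr \<mu> borel (\<lambda>x. ?R * x)) d m ((m + 1) div d)"
    proof
      show "m + 1 = d * ((m + 1) div d)" using dvd by (metis mod_0_imp_dvd dvd_mult_div_cancel)
      fix A :: "real set" assume A [measurable]: "A \<in> sets borel"
      \<comment> \<open>Multiplication by \<open>?R\<close> conjugates the given maps to the digit
        maps.\<close>
      have eq: "?R * ifs_map d m j x = (?R * x + real j) / d" for j x
        using d2 dm by (simp add: ifs_map_def divide_simps)
      have "measure (distr \<mu> borel (\<lambda>x. ?R * x)) A = measure \<mu> ((\<lambda>x. ?R * x) -` A)"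
        by (subst measure_distr) (auto simp: sp)
      also have "\<dots> = (\<Sum>j=0..m. 1 / (real m + 1) * measure \<mu> (ifs_map d m j -` (\<lambda>x. ?R * x) -` A))"
        by (intro ss measurable_sets_borel[OF _ A]) simp
      also have "\<dots> = (\<Sum>j\<le>m. measure \<mu> {x. (?R * x + real j) / d \<in> A}) / (real m + 1)"
        by (simp only: sum_divide_distrib vimage_def mem_Collect_eq eq atLeast0AtMost) simp
      also have "\<dots> = (\<Sum>j\<le>m. measure (distr \<mu> borel (\<lambda>x. ?R * x)) {w. (w + real j) / d \<in> A}) / (real m + 1)"
        by (subst measure_distr) (auto simp: sp vimage_def)
      finally show "measure (distr \<mu> borel (\<lambda>x. ?R * x)) A =
        (\<Sum>j\<le>m. measure (distr \<mu> borel (\<lambda>x. ?R * x)) {w. (w + real j) / d \<in> A}) / (real m + 1)"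
        by simp
    qed (use d2 dm in auto)
  qed
qed

text \<open>The reflection exchanges maps \<open>j\<close> and \<open>m - j\<close>, and equal
  weights are symmetric under this exchange.\<close>

lemma self_similar_reflect:
  assumes "self_similar_measure m (\<lambda>j. 1 / (real m + 1)) (ifs_map d m) \<mu>"
  shows "self_similar_measure m (\<lambda>j. 1 / (real m + 1)) (ifs_map d m) (distr \<mu> borel (\<lambda>x. 1 - x))"
proof -
  have \<mu>: "prob_space \<mu>" and sets [simp, measurable_cong]: "sets \<mu> = sets borel"
    and ss: "\<And>A. A \<in> sets borel \<Longrightarrow> measure \<mu> A = (\<Sum>j=0..m. 1 / (real m + 1) * measure \<mu> (ifs_map d m j -` A))"
    using assms by (auto simp: self_similar_measure_def)
  have sp: "space \<mu> = UNIV" using sets_eq_imp_space_eq[OF sets] by simp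
  interpret prob_space \<mu> by fact
  have meas: "measure (distr \<mu> borel (\<lambda>x. 1 - x)) A = measure \<mu> {x. 1 - x \<in> A}" if "A \<in> sets borel" for A
    using that by (subst measure_distr) (auto simp: sp vimage_def)
  have eq: "1 - ifs_map d m (m - j) x = ifs_map d m j (1 - x)" if "j \<le> m" for j x
    using that d2 dm by (simp add: ifs_map_def of_nat_diff divide_simps) (simp add: algebra_simps)
  have ifs [measurable]: "ifs_map d m j \<in> borel_measurable borel" for j
    unfolding ifs_map_def by measurable
  have "measure (distr \<mu> borel (\<lambda>x. 1 - x)) A =
      (\<Sum>j=0..m. 1 / (real m + 1) * measure (distr \<mu> borel (\<lambda>x. 1 - x)) (ifs_map d m j -` A))"
    if A [measurable]: "A \<in> sets borel" for A
  proof -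
    have "measure (distr \<mu> borel (\<lambda>x. 1 - x)) A = (\<Sum>j=0..m. 1 / (real m + 1) * measure \<mu> (ifs_map d m j -` {x. 1 - x \<in> A}))"
      unfolding meas[OF A] by (rule ss) measurable
    also have "\<dots> = (\<Sum>j=0..m. 1 / (real m + 1) * measure \<mu> (ifs_map d m (m - j) -` {x. 1 - x \<in> A}))"
      by (subst sum.atLeastAtMost_rev) simp
    also have "\<dots> = (\<Sum>j=0..m. 1 / (real m + 1) * measure \<mu> {x. 1 - x \<in> ifs_map d m j -` A})"
      by (intro sum.cong) (auto simp: vimage_def eq)
    also have "\<dots> = (\<Sum>j=0..m. 1 / (real m + 1) * measure (distr \<mu> borel (\<lambda>x. 1 - x)) (ifs_map d m j -` A))"
      by (subst meas) (simp_all add: measurable_sets_borel[OF ifs])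
    finally show ?thesis .
  qed
  moreover have "prob_space (distr \<mu> borel (\<lambda>x. 1 - x))"
    by (rule prob_space_distr) simp
  ultimately show ?thesis unfolding self_similar_measure_def by simp
qed

context
  fixes \<mu> :: "real measure"
  assumes \<mu>: "self_similar_measure m (\<lambda>j. 1 / (real m + 1)) (ifs_map d m) \<mu>"
begin

lemma sets_self_similar: "sets \<mu> = sets borel"
  using \<mu> by (simp add: self_similar_measure_def)

lemma measure_Icc_rescale:
  assumes "c > 0"
  shows "measure \<mu> {x - r..x + r} = measure (distr \<mu> borel (\<lambda>x. c * x)) {c * x - c * r..c * x + c * r}"
proof -
  have "{y. c * y \<in> {c * x - c * r..c * x + c * r}} = {x - r..x + r}"
    using assms by (auto simp flip: distrib_left right_diff_distrib)
  then show ?thesis using measure_rescale[OF sets_self_similar] by simp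
qed

lemma regular_interior:
  assumes "0 < x" "x < 1"
  shows "regular_at \<mu> x 1"
proof -
  interpret digit_law "distr \<mu> borel (\<lambda>x. m / (real d - 1) * x)" d m "(m + 1) div d"
    by (rule digit_law_rescale[OF \<mu>])
  have "0 < R * x" "R * x < R" using R_pos assms by auto
  from regular_at_interior[OF this] R_pos show ?thesis
    by (rule regular_at_affine)
       (use measure_Icc_rescale[OF R_pos] in \<open>simp add: R_def\<close>)
qed

lemma regular_0: "regular_at \<mu> 0 (ln (real m + 1) / ln d)"
proof -
  interpret digit_law "distr \<mu> borel (\<lambda>x. m / (real d - 1) * x)" d m "(m + 1) div d"
    by (rule digit_law_rescale[OF \<mu>])
  show ?thesis
    using regular_at_affine[OF regular_at_0 R_pos] measure_Icc_rescale[OF R_pos, of 0]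
    unfolding R_def by simp
qed

text \<open>The complement of \<open>[0, 1]\<close> is an open null set. This confines
  \<open>local_dims\<close> to points whose dimension has been computed.\<close>

lemma support_subset: "measure_support \<mu> \<subseteq> {0..1}"
proof -
  interpret digit_law "distr \<mu> borel (\<lambda>x. m / (real d - 1) * x)" d m "(m + 1) div d"
    by (rule digit_law_rescale[OF \<mu>])
  have "{x. R * x \<in> outer 0} = - {0..1}"
    using R_pos by (auto simp: outer_def mult_less_0_iff)
  then have "measure \<mu> (- {0..1}) = 0"
    using outer_null measure_rescale[OF sets_self_similar outer_borel, of R 0]
    unfolding R_def by simp
  moreover have "open (- {0..1::real})" by auto
  ultimately show ?thesis unfolding measure_support_def by force
qed

end

end

theorem mainTheorem14:
  fixes d m :: nat and \<mu> :: "real measure"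
  assumes "d \<ge> 2" and "m \<ge> d" and "(m + 1) mod d = 0"
    and "self_similar_measure m (\<lambda>j. 1 / (real m + 1)) (ifs_map d m) \<mu>"
  shows "(\<forall>x\<in>{0<..<1}. has_local_dim \<mu> x 1) \<and>
    has_local_dim \<mu> 0 (ln (real m + 1) / ln (real d)) \<and>
    has_local_dim \<mu> 1 (ln (real m + 1) / ln (real d)) \<and>
    ln (real m + 1) / ln (real d) > 1 \<and>
    card (local_dims \<mu>) = 2"
proof -
  define s where "s = ln (real m + 1) / ln (real d)"
  note int = regular_interior[OF assms]
  note at0 = regular_0[OF assms, folded s_def]
  have sets [simp, measurable_cong]: "sets \<mu> = sets borel" by (rule sets_self_similar[OF assms])
  interpret prob_space \<mu> using assms(4) by (simp add: self_similar_measure_def)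
  have at1: "regular_at \<mu> 1 s"
  proof (rule regular_at_affine[where c = 1])
    show "regular_at (distr \<mu> borel (\<lambda>x. 1 - x)) 0 s"
      unfolding s_def by (rule regular_0[OF assms(1-3) self_similar_reflect[OF assms]])
    fix r :: real
    have "{x. 1 - x \<in> {- r..r}} = {1 - r..1 + r}" by auto
    then show "measure \<mu> {1 - r..1 + r} = measure (distr \<mu> borel (\<lambda>x. 1 - x)) {0 - 1 * r..0 + 1 * r}"
      by (subst measure_distr) (auto simp: vimage_def sets_eq_imp_space_eq[OF sets])
  qed simp
  have s1: "s > 1" using assms(1,2) by (simp add: s_def)
  \<comment> \<open>Limits along the nontrivial filter \<open>at_right 0\<close> are unique, so no
    further value can enter \<open>local_dims\<close>.\<close>
  have uniq: "u = v" if "has_local_dim \<mu> x u" "has_local_dim \<mu> x v" for x u v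
    using that unfolding has_local_dim_def by (rule tendsto_unique[rotated]) simp
  have supp: "measure_support \<mu> \<subseteq> {0..1}" by (rule support_subset[OF assms])
  have sup: "x \<in> measure_support \<mu>" if "regular_at \<mu> x u" for x u
    by (rule regular_at_support[OF that]) (unfold_locales, simp)
  have "local_dims \<mu> = {1, s}"
  proof
    show "{1, s} \<subseteq> local_dims \<mu>"
      using int[of "1/2"] at0 sup regular_at_has_local_dim unfolding local_dims_def by force
    show "local_dims \<mu> \<subseteq> {1, s}"
    proof
      fix u assume "u \<in> local_dims \<mu>"
      then obtain x where x: "x \<in> {0..1}" "has_local_dim \<mu> x u"
        using supp unfolding local_dims_def by blast
      then consider "x = 0" | "x = 1" | "0 < x" "x < 1" by force
      then show "u \<in> {1, s}"
        using x(2) uniq int at0 at1 regular_at_has_local_dim by cases blast+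
    qed
  qed
  then show ?thesis
    using int at0 at1 s1 regular_at_has_local_dim unfolding s_def[symmetric] by auto
qed

end
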